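(* Let $K\subset \mathbb{R}^n$ be a proper convex cone and $d\ge 0$. A form $f\in \mathbb{R}[x]_n^d$ is $K$-Lorentzian if and only if $f$ is $K$-completely log-concave. Equivalently, $\mathrm{SL}^d(K)=\mathrm{CLC}^d(K)$.
   Context: $\mathbb{R}[x]_n^d$ denotes the vector space of real homogeneous polynomials (forms) of degree $d$ in $n$ variables. A convex cone $K\subset\mathbb{R}^n$ is proper if it is closed, pointed ($K\cap(-K)=\{0\}$) and has nonempty interior $\mathrm{int}\,K$. For $a\in\mathbb{R}^n$, $D_af=\sum_{i=1}^n a_i\,\partial f/\partial x_i$. The matrix of a quadratic form $q$ is the symmetric matrix $Q$ with $q(x)=x^tQx$. $K$-Lorentzian: a form $f\in\mathbb{R}[x]_n^d$ with $d\ge 2$ is $K$-Lorentzian if either $f=0$ or, for all $a_1,\dots,a_{d-2}\in\mathrm{int}\,K$, the matrix $Q$ of the quadratic form $q=D_{a_1}\cdots D_{a_{d-2}}f$ satisfies: (1) $Q$ has exactly one positive eigenvalue; (2) $y^tQx>0$ for all $x,y\in\mathrm{int}\,K$. For $d\le 1$ a form is $K$-Lorentzian if it is nonnegative on $K$. $\mathrm{SL}^d(K)$ is the set of $K$-Lorentzian forms in $\mathbb{R}[x]_n^d$. Log-concavity: a form $f$ is log-concave at $a\in\mathbb{R}^n$ if $f(a)>0$ and the Hessian of $\log f$ at $a$ is negative semidefinite; by convention the zero polynomial is log-concave at all points. A form is log-concave on $\mathrm{int}\,K$ if it is log-concave at every point of $\mathrm{int}\,K$. $K$-completely log-concave ($K$-CLC):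 $f\in\mathbb{R}[x]_n^d$ is $K$-CLC if for every $0\le m\le d$ and all $a_1,\dots,a_m\in K$, the form $D_{a_1}\cdots D_{a_m}f$ is log-concave on $\mathrm{int}\,K$. $\mathrm{CLC}^d(K)$ is the set of $K$-CLC forms in $\mathbb{R}[x]_n^d$. *)

theory Defs
  imports "HOL-Analysis.Analysis"
begin

text \<open>
  Real forms in \<open>n = CARD('n)\<close> variables are identified with the functions on \<open>\<real>\<^sup>n\<close> they
  induce. This is harmless because \<open>\<real>\<close> is infinite: the coefficients are determined by the
  function, and the analytic partial derivatives below agree with the formal ones.
  The zero form has every degree.
\<close>

definition forms :: "nat \<Rightarrow> (real ^ 'n \<Rightarrow> real) set" where
  "forms d = {f. \<exists>c :: ('n \<Rightarrow> nat) \<Rightarrow> real.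
     f = (\<lambda>x. \<Sum>\<alpha> | (\<Sum>i\<in>UNIV. \<alpha> i) = d. c \<alpha> * (\<Prod>i\<in>UNIV. (x $ i) ^ \<alpha> i))}"

definition proper_cone :: "(real ^ 'n) set \<Rightarrow> bool" where
  "proper_cone K \<longleftrightarrow>
     convex_cone K \<and> closed K \<and> K \<inter> uminus ` K = {0} \<and> interior K \<noteq> {}"

definition partial_deriv :: "'n \<Rightarrow> (real ^ 'n \<Rightarrow> real) \<Rightarrow> real ^ 'n \<Rightarrow> real" where
  "partial_deriv i f x = deriv (\<lambda>t. f (x + t *\<^sub>R axis i 1)) 0"

definition dir_deriv :: "real ^ 'n \<Rightarrow> (real ^ 'n \<Rightarrow> real) \<Rightarrow> real ^ 'n \<Rightarrow> real" where
  "dir_deriv a f x = (\<Sum>i\<in>UNIV. a $ i * partial_deriv i f x)"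

definition dir_derivs :: "(real ^ 'n) list \<Rightarrow> (real ^ 'n \<Rightarrow> real) \<Rightarrow> real ^ 'n \<Rightarrow> real" where
  "dir_derivs as f = foldr dir_deriv as f"

definition hessian :: "(real ^ 'n \<Rightarrow> real) \<Rightarrow> real ^ 'n \<Rightarrow> real ^ 'n ^ 'n" where
  "hessian f a = (\<chi> i j. partial_deriv i (partial_deriv j f) a)"

definition neg_semidefinite :: "real ^ 'n ^ 'n \<Rightarrow> bool" where
  "neg_semidefinite A \<longleftrightarrow> transpose A = A \<and> (\<forall>v. v \<bullet> (A *v v) \<le> 0)"

definition quad_matrix :: "(real ^ 'n \<Rightarrow> real) \<Rightarrow> real ^ 'n ^ 'n" where
  "quad_matrix q = (THE Q. transpose Q = Q \<and> (\<forall>x. q x = x \<bullet> (Q *v x)))"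

text \<open>The description in \<open>quad_matrix\<close> is proper: a symmetric matrix is determined by its form.\<close>

lemma quad_matrix_eq:
  fixes Q :: "real ^ 'n ^ 'n"
  assumes "transpose Q = Q" and "\<And>x. q x = x \<bullet> (Q *v x)"
  shows "quad_matrix q = Q"
  unfolding quad_matrix_def
proof (rule the_equality)
  show "transpose Q = Q \<and> (\<forall>x. q x = x \<bullet> (Q *v x))"
    using assms by blast
next
  have polar: "(x + y) \<bullet> (P *v (x + y)) - x \<bullet> (P *v x) - y \<bullet> (P *v y) = 2 * (x \<bullet> (P *v y))"
    if "transpose P = P" for P :: "real ^ 'n ^ 'n" and x y
  proof -
    have "y \<bullet> (P *v x) = x \<bullet> (P *v y)"
      by (metis that dot_lmul_matrix inner_commute transpose_matrix_vector)
    then show ?thesis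
      by (simp add: matrix_vector_right_distrib inner_add_left inner_add_right)
  qed
  fix P assume P: "transpose P = P \<and> (\<forall>x. q x = x \<bullet> (P *v x))"
  have "x \<bullet> (P *v y) = x \<bullet> (Q *v y)" for x y
    using polar[of P x y] polar[of Q x y] P assms by (metis mult_left_cancel zero_neq_numeral)
  then have "P *v y = Q *v y" for y
    by (metis vector_eq_ldot)
  then show "P = Q"
    by (simp add: matrix_eq)
qed

text \<open>
  Eigenvalues are counted with multiplicity. For the symmetric matrices considered here the
  geometric multiplicity, i.e. the dimension of the eigenspace, is also the algebraic one.
\<close>

definition num_pos_eigenvalues :: "real ^ 'n ^ 'n \<Rightarrow> nat" where
  "num_pos_eigenvalues A =
     (\<Sum>c | c > 0 \<and> (\<exists>v. v \<noteq> 0 \<and> A *v v = c *\<^sub>R v). dim {v. A *v v = c *\<^sub>R v})"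

definition lorentzian :: "(real ^ 'n) set \<Rightarrow> nat \<Rightarrow> (real ^ 'n \<Rightarrow> real) \<Rightarrow> bool" where
  "lorentzian K d f \<longleftrightarrow>
     (if d \<le> 1 then \<forall>x\<in>K. f x \<ge> 0
      else f = (\<lambda>x. 0) \<or>
        (\<forall>as. length as = d - 2 \<and> set as \<subseteq> interior K \<longrightarrow>
           (let Q = quad_matrix (dir_derivs as f)
            in num_pos_eigenvalues Q = 1 \<and>
               (\<forall>x\<in>interior K. \<forall>y\<in>interior K. y \<bullet> (Q *v x) > 0))))"

definition SL :: "nat \<Rightarrow> (real ^ 'n) set \<Rightarrow> (real ^ 'n \<Rightarrow> real) set" where
  "SL d K = {f \<in> forms d. lorentzian K d f}"

definition log_concave_at :: "(real ^ 'n \<Rightarrow> real) \<Rightarrow> real ^ 'n \<Rightarrow> bool" where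
  "log_concave_at f a \<longleftrightarrow>
     f = (\<lambda>x. 0) \<or> f a > 0 \<and> neg_semidefinite (hessian (\<lambda>x. ln (f x)) a)"

definition completely_log_concave ::
    "(real ^ 'n) set \<Rightarrow> nat \<Rightarrow> (real ^ 'n \<Rightarrow> real) \<Rightarrow> bool" where
  "completely_log_concave K d f \<longleftrightarrow>
     (\<forall>as. length as \<le> d \<and> set as \<subseteq> K \<longrightarrow>
        (\<forall>x\<in>interior K. log_concave_at (dir_derivs as f) x))"

definition CLC :: "nat \<Rightarrow> (real ^ 'n) set \<Rightarrow> (real ^ 'n \<Rightarrow> real) set" where
  "CLC d K = {f \<in> forms d. completely_log_concave K d f}"

end

theory Submission
  imports Defs
begin

text \<open>
  For a form \<open>f\<close> of degree \<open>d\<close> and vectors \<open>b\<^sub>1, \<dots>, b\<^sub>d\<close> the iterated derivative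
  \<open>D\<^bsub>b\<^sub>1\<^esub> \<dots> D\<^bsub>b\<^sub>d\<^esub> f\<close> is a constant; as a function of the \<open>b\<^sub>i\<close> it is, up to the
  factor \<open>d!\<close>, the symmetric multilinear polarization of \<open>f\<close>. It is written
  \<open>dir_derivs bs f 0\<close> below. Both sides of the theorem are statements about these mixed values on
  \<open>K\<close>, because a derivative \<open>g\<close> of degree \<open>k\<close> is recovered from them by
  \<open>k! g(x) = D\<^sub>x\<^sup>k g\<close> (\<open>dir_derivs_replicate\<close>, iterating Euler's identity), and because
  the Hessian of \<open>ln g\<close> at a point where \<open>g > 0\<close> is negative semidefinite iff
  \<open>g D\<^sub>v D\<^sub>v g \<le> (D\<^sub>v g)\<^sup>2\<close> for all \<open>v\<close> (\<open>log_concave_at_iff\<close>).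

  From Lorentzian to completely log-concave. A symmetric \<open>Q\<close> with exactly one positive
  eigenvalue satisfies the reversed Cauchy-Schwarz inequality
  \<open>(v \<bullet> Q v) (x \<bullet> Q x) \<le> (v \<bullet> Q x)\<^sup>2\<close> whenever \<open>x \<bullet> Q x > 0\<close>
  (\<open>reverse_Cauchy_Schwarz\<close>). Applied to the quadratic derivatives of \<open>f\<close> this is the
  Alexandrov-Fenchel inequality for the mixed values with directions in the interior of \<open>K\<close>, and
  by continuity it holds for directions in \<open>K\<close>. Specializing all remaining directions to \<open>x\<close>
  gives the log-concavity inequality for every derivative of \<open>f\<close>; the factorials that relate
  mixed values to derivatives only help. Strict positivity at interior points survives the passage
  from the interior to \<open>K\<close> by a dichotomy: if the mixed values of a form on \<open>K\<close> are
  nonnegative and one of them with interior directions is zero, the form is zero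
  (\<open>eq_zero_if_mixed_zero\<close>).

  From completely log-concave to Lorentzian. Derivatives of order \<open>d\<close> show that the mixed
  values on \<open>K\<close> are nonnegative, and the same dichotomy makes them positive for interior
  directions unless \<open>f = 0\<close>. If \<open>q(x) = x \<bullet> Q x\<close> is a derivative of order \<open>d - 2\<close>
  in interior directions and \<open>e\<close> an interior point, then log-concavity of \<open>q\<close> at \<open>e\<close>
  says that \<open>Q\<close> is negative semidefinite on the hyperplane \<open>(Q e)\<^sup>\<bottom>\<close>. Since
  \<open>e \<bullet> Q e > 0\<close>, there is exactly one positive eigenvalue
  (\<open>num_pos_eigenvalues_eq_one\<close>).
\<close>

section \<open>Symmetric matrices with one positive eigenvalue\<close>

lemma symmetric_inner_commute:
  fixes Q :: "real ^ 'n ^ 'n"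
  assumes "transpose Q = Q"
  shows "u \<bullet> (Q *v v) = v \<bullet> (Q *v u)"
  by (metis assms dot_lmul_matrix inner_commute transpose_matrix_vector)

lemma quadratic_form_add_scaled:
  fixes Q :: "real ^ 'n ^ 'n"
  assumes "transpose Q = Q"
  shows "(u + t *\<^sub>R v) \<bullet> (Q *v (u + t *\<^sub>R v))
           = u \<bullet> (Q *v u) + 2 * t * (u \<bullet> (Q *v v)) + t\<^sup>2 * (v \<bullet> (Q *v v))"
  using symmetric_inner_commute[OF assms, of u v]
  by (simp add: matrix_vector_right_distrib matrix_vector_mult_scaleR inner_add_left
      inner_add_right power2_eq_square algebra_simps)

text \<open>
  Near \<open>t = 0\<close> the linear term dominates and changes sign.
\<close>

lemma linear_coeff_zero_if_quadratic_nonneg: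
  fixes a b :: real
  assumes "\<And>t. 0 \<le> b * t + a * t\<^sup>2"
  shows "b = 0"
proof (rule ccontr)
  assume b: "b \<noteq> 0"
  \<comment> \<open>At \<open>t = - s b\<close> the value is \<open>s b\<^sup>2 (a s - 1)\<close>, negative once \<open>a s < 1\<close>.\<close>
  define s where "s = 1 / (\<bar>a\<bar> + 1)"
  have s: "s > 0" "\<bar>a\<bar> * s < 1" by (simp_all add: s_def)
  have "0 \<le> b * (- (s * b)) + a * (- (s * b))\<^sup>2" by (rule assms)
  also have "\<dots> = s * b\<^sup>2 * (a * s - 1)"
    by (simp add: power2_eq_square algebra_simps)
  also have "\<dots> < 0"
  proof -
    have "a * s \<le> \<bar>a\<bar> * s" using s by (intro mult_right_mono) auto
    then have "a * s - 1 < 0" using s by linarith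
    then show ?thesis using b s by (simp add: mult_pos_neg)
  qed
  finally show False by simp
qed

text \<open>
  The part of the spectral theorem that is needed: the maximum of the quadratic form on the unit
  sphere of an invariant subspace is an eigenvalue, attained at an eigenvector.
\<close>

lemma exists_maximal_eigenvector:
  fixes Q :: "real ^ 'n ^ 'n"
  assumes sym: "transpose Q = Q" and S: "subspace S"
    and inv: "\<And>v. v \<in> S \<Longrightarrow> Q *v v \<in> S" and w: "w \<in> S" "w \<noteq> 0"
  obtains u c where "u \<in> S" "norm u = 1" "Q *v u = c *\<^sub>R u"
    "\<And>v. v \<in> S \<Longrightarrow> v \<bullet> (Q *v v) \<le> c * (v \<bullet> v)"
proof -
  let ?q = "\<lambda>v. v \<bullet> (Q *v v)"
  have "compact (S \<inter> sphere 0 1)"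
    using closed_subspace[OF S] by (simp add: compact_Int_closed closed_Int_compact)
  moreover have "(1 / norm w) *\<^sub>R w \<in> S \<inter> sphere 0 1"
    using w S by (simp add: subspace_scale)
  then have "S \<inter> sphere 0 1 \<noteq> {}" by blast
  moreover have "continuous_on (S \<inter> sphere 0 1) ?q"
    by (intro continuous_intros linear_continuous_on_compose[OF continuous_on_id]) auto
  ultimately have "\<exists>u\<in>S \<inter> sphere 0 1. \<forall>v\<in>S \<inter> sphere 0 1. ?q v \<le> ?q u"
    by (rule continuous_attains_sup)
  then obtain u where u: "u \<in> S \<inter> sphere 0 1"
      and max: "\<And>v. v \<in> S \<inter> sphere 0 1 \<Longrightarrow> ?q v \<le> ?q u" by blast
  define c where "c = ?q u"
  have uu: "u \<bullet> u = 1" using u by (simp add: dot_square_norm)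
  have bound: "?q v \<le> c * (v \<bullet> v)" if v: "v \<in> S" for v
  proof (cases "v = 0")
    case False
    then have "?q ((1 / norm v) *\<^sub>R v) \<le> c"
      unfolding c_def using v S by (intro max) (simp add: subspace_scale)
    then have "?q v / (norm v)\<^sup>2 \<le> c"
      by (simp add: matrix_vector_mult_scaleR power2_eq_square)
    then show ?thesis using False by (simp add: dot_square_norm divide_le_eq)
  qed simp
  \<comment> \<open>The form \<open>c |v|\<^sup>2 - v \<bullet> Q v\<close> is nonnegative on \<open>S\<close> and vanishes at \<open>u\<close>, so \<open>u\<close> is in its radical.\<close>
  have orth: "(c *\<^sub>R u - Q *v u) \<bullet> v = 0" if v: "v \<in> S" for v
  proof -
    have "0 \<le> 2 * (c * (u \<bullet> v) - u \<bullet> (Q *v v)) * t + (c * (v \<bullet> v) - ?q v) * t\<^sup>2" for t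
    proof -
      have "u + t *\<^sub>R v \<in> S" using u v S by (simp add: subspace_add subspace_scale)
      from bound[OF this] show ?thesis
        unfolding quadratic_form_add_scaled[OF sym]
        using uu by (simp add: c_def inner_add_left inner_add_right inner_commute
            power2_eq_square algebra_simps)
    qed
    from linear_coeff_zero_if_quadratic_nonneg[OF this] show ?thesis
      using symmetric_inner_commute[OF sym, of u v] by (simp add: inner_diff_right inner_commute)
  qed
  have "c *\<^sub>R u - Q *v u \<in> S"
    using u S inv by (simp add: subspace_diff subspace_scale)
  from orth[OF this] have "Q *v u = c *\<^sub>R u" by simp
  then show thesis using that[of u c] u bound by auto
qed

text \<open>
  Each positive eigenvalue contributes at least one to the multiplicity count, so a count of one
  leaves a single positive eigenvalue with a one-dimensional eigenspace. A sum over an infinite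
  index set is zero, so the count also forces finiteness.
\<close>

lemma num_pos_eigenvalues_oneD:
  fixes A :: "real ^ 'n ^ 'n"
  assumes "num_pos_eigenvalues A = 1"
  obtains u c where "u \<noteq> 0" "c > 0" "A *v u = c *\<^sub>R u"
    "\<And>w b. b > 0 \<Longrightarrow> A *v w = b *\<^sub>R w \<Longrightarrow> w \<in> span {u}"
proof -
  define E where "E = (\<lambda>c. {v. A *v v = c *\<^sub>R v})"
  define C where "C = {c. c > 0 \<and> (\<exists>v. v \<noteq> 0 \<and> A *v v = c *\<^sub>R v)}"
  have sum1: "(\<Sum>c\<in>C. dim (E c)) = 1"
    using assms by (simp add: num_pos_eigenvalues_def C_def E_def)
  have fin: "finite C" using sum1 by (rule contrapos_pp) (simp add: sum.infinite)
  have pos: "1 \<le> dim (E c)" if "c \<in> C" for c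
  proof -
    from that obtain v where "v \<noteq> 0" "v \<in> E c" by (auto simp: C_def E_def)
    then have "\<not> E c \<subseteq> {0}" by blast
    then have "dim (E c) \<noteq> 0" by (simp only: dim_eq_0 not_False_eq_True)
    then show ?thesis by linarith
  qed
  have "card C \<le> 1"
    using sum_mono[of C "\<lambda>_. 1" "\<lambda>c. dim (E c)", OF pos] sum1 by simp
  moreover have "C \<noteq> {}" using sum1 by force
  then have "card C \<noteq> 0" using fin by simp
  ultimately have "card C = 1" by linarith
  then obtain c where c: "C = {c}" by (rule card_1_singletonE)
  then have dim1: "dim (E c) = 1" using sum1 by simp
  have "c \<in> C" using c by blast
  then obtain u where u: "u \<noteq> 0" "A *v u = c *\<^sub>R u" and c0: "c > 0"
    unfolding C_def by blast
  have sub: "E c \<subseteq> span {u}"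
    using card_ge_dim_independent[of "{u}" "E c"] u dim1 by (simp add: E_def)
  have only: "w \<in> span {u}" if w: "b > 0" "A *v w = b *\<^sub>R w" for w b
  proof (cases "w = 0")
    case False
    then have "b \<in> C" using w unfolding C_def by blast
    then show ?thesis using c w sub by (auto simp: E_def)
  qed (simp add: span_zero)
  show thesis by (rule that[OF u(1) c0 u(2) only])
qed

text \<open>
  A form with exactly one positive eigenvalue is negative semidefinite on the hyperplane
  orthogonal to the positive eigenvector. This hyperplane does not contain \<open>x\<close>, so every \<open>v\<close>
  can be moved into it by adding a multiple of \<open>x\<close>. The form is then nonpositive at some point
  \<open>v + t x\<close>, and as a quadratic in \<open>t\<close> with positive leading coefficient it has a nonnegative
  discriminant, which is the Cauchy-Schwarz inequality with the sign reversed.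
\<close>

lemma reverse_Cauchy_Schwarz:
  fixes Q :: "real ^ 'n ^ 'n"
  assumes sym: "transpose Q = Q" and one: "num_pos_eigenvalues Q = 1"
    and x: "x \<bullet> (Q *v x) > 0"
  shows "(v \<bullet> (Q *v v)) * (x \<bullet> (Q *v x)) \<le> (v \<bullet> (Q *v x))\<^sup>2"
proof -
  obtain u c where u: "u \<noteq> 0" "c > 0" "Q *v u = c *\<^sub>R u"
    and only: "\<And>w b. b > 0 \<Longrightarrow> Q *v w = b *\<^sub>R w \<Longrightarrow> w \<in> span {u}"
    using num_pos_eigenvalues_oneD[OF one] by metis
  define S where "S = {w. u \<bullet> w = 0}"
  have S: "subspace S" unfolding S_def by (rule subspace_hyperplane)
  have inv: "Q *v w \<in> S" if "w \<in> S" for w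
    using that symmetric_inner_commute[OF sym, of u w] u
    by (simp add: S_def inner_commute)
  have nsd: "w \<bullet> (Q *v w) \<le> 0" if w: "w \<in> S" for w
  proof (cases "w = 0")
    case False
    obtain z b where z: "z \<in> S" "norm z = 1" "Q *v z = b *\<^sub>R z"
      and bd: "\<And>v. v \<in> S \<Longrightarrow> v \<bullet> (Q *v v) \<le> b * (v \<bullet> v)"
      using exists_maximal_eigenvector[OF sym S inv w False] by metis
    have "b \<le> 0"
    proof (rule ccontr)
      assume "\<not> b \<le> 0"
      then have "z \<in> span {u}" using only[of b z] z by simp
      then obtain k where "z = k *\<^sub>R u" by (auto simp: span_singleton)
      then show False using z u by (auto simp: S_def)
    qed
    then show ?thesis using bd[OF w] by (smt (verit) inner_ge_zero mult_nonpos_nonneg)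
  qed simp
  have ux: "u \<bullet> x \<noteq> 0" using nsd[of x] x by (auto simp: S_def)
  define t where "t = - (u \<bullet> v) / (u \<bullet> x)"
  have "v + t *\<^sub>R x \<in> S" using ux by (simp add: S_def t_def inner_diff_right)
  from nsd[OF this] have le: "v \<bullet> (Q *v v) + 2 * t * (v \<bullet> (Q *v x)) + t\<^sup>2 * (x \<bullet> (Q *v x)) \<le> 0"
    unfolding quadratic_form_add_scaled[OF sym] .
  let ?a = "v \<bullet> (Q *v v)" and ?b = "v \<bullet> (Q *v x)" and ?c = "x \<bullet> (Q *v x)"
  \<comment> \<open>Completing the square in \<open>t\<close>.\<close>
  have "?a * ?c - ?b\<^sup>2 = (?a + 2 * t * ?b + t\<^sup>2 * ?c) * ?c - (?b + t * ?c)\<^sup>2"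
    by (simp add: power2_eq_square algebra_simps)
  also have "\<dots> \<le> 0"
    using mult_right_mono[OF le, of ?c] x by (smt (verit) mult_zero_left zero_le_power2)
  finally show ?thesis by simp
qed

text \<open>
  Conversely, two independent eigenvectors with positive eigenvalues would span a plane on which
  \<open>Q\<close> is positive definite, and this plane would meet the hyperplane \<open>(Q x)\<^sup>\<bottom>\<close>.
\<close>

lemma num_pos_eigenvalues_eq_one:
  fixes Q :: "real ^ 'n ^ 'n"
  assumes sym: "transpose Q = Q" and x: "x \<bullet> (Q *v x) > 0"
    and nsd: "\<And>v. v \<bullet> (Q *v x) = 0 \<Longrightarrow> v \<bullet> (Q *v v) \<le> 0"
  shows "num_pos_eigenvalues Q = 1"
proof -
  let ?E = "\<lambda>c. {v. Q *v v = c *\<^sub>R v}"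
  let ?C = "{c. c > 0 \<and> (\<exists>v. v \<noteq> 0 \<and> Q *v v = c *\<^sub>R v)}"
  have sub: "subspace (?E c)" for c
    by (auto simp: subspace_def matrix_vector_right_distrib matrix_vector_mult_scaleR
        scaleR_add_right)
  have "x \<noteq> 0" using x by auto
  then obtain u c where u: "norm u = 1" "Q *v u = c *\<^sub>R u"
    and bd: "\<And>v. v \<bullet> (Q *v v) \<le> c * (v \<bullet> v)"
    using exists_maximal_eigenvector[OF sym subspace_UNIV, of x] by auto
  have u0: "u \<noteq> 0" using u by auto
  have c0: "c > 0"
    using x bd[of x] by (smt (verit) inner_ge_zero mult_nonpos_nonneg)
  have ux: "u \<bullet> (Q *v x) \<noteq> 0"
    using nsd[of u] u c0 by (auto simp: dot_square_norm)
  have par: "b = c \<and> w \<in> span {u}" if w: "w \<noteq> 0" "b > 0" "Q *v w = b *\<^sub>R w" for w b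
  proof -
    have orth: "b \<noteq> c \<Longrightarrow> u \<bullet> w = 0"
      using symmetric_inner_commute[OF sym, of u w] u w by (simp add: inner_commute)
    \<comment> \<open>The point of the plane spanned by \<open>u\<close> and \<open>w\<close> that lies in the hyperplane \<open>(Q x)\<^sup>\<bottom>\<close>.\<close>
    define t where "t = - (w \<bullet> (Q *v x)) / (u \<bullet> (Q *v x))"
    have "(w + t *\<^sub>R u) \<bullet> (Q *v x) = 0" using ux by (simp add: t_def inner_diff_left)
    from nsd[OF this]
    have le: "w \<bullet> (Q *v w) + 2 * t * (w \<bullet> (Q *v u)) + t\<^sup>2 * (u \<bullet> (Q *v u)) \<le> 0"
      unfolding quadratic_form_add_scaled[OF sym] .
    have ww: "w \<bullet> w > 0" and uu: "u \<bullet> u > 0" using w u0 by auto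
    have "b = c"
    proof (rule ccontr)
      assume "b \<noteq> c"
      with orth le have "b * (w \<bullet> w) + t\<^sup>2 * (c * (u \<bullet> u)) \<le> 0"
        using u w by (simp add: inner_commute)
      moreover have "b * (w \<bullet> w) > 0" using ww w by simp
      moreover have "t\<^sup>2 * (c * (u \<bullet> u)) \<ge> 0" using uu c0 by simp
      ultimately show False by linarith
    qed
    moreover have "w + t *\<^sub>R u = 0"
    proof -
      have "c * ((w + t *\<^sub>R u) \<bullet> (w + t *\<^sub>R u)) \<le> 0"
        using le u w \<open>b = c\<close> by (simp add: inner_commute inner_add_left inner_add_right
            power2_eq_square algebra_simps)
      then have "(w + t *\<^sub>R u) \<bullet> (w + t *\<^sub>R u) \<le> 0" using c0 by (simp add: mult_le_0_iff)
      then show ?thesis by (metis inner_eq_zero_iff inner_ge_zero order_antisym)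
    qed
    then have "w = (- t) *\<^sub>R u" by (simp add: eq_neg_iff_add_eq_0)
    then have "w \<in> span {u}" by (metis span_base span_scale singletonI)
    ultimately show ?thesis by simp
  qed
  have C: "?C = {c}"
  proof
    show "{c} \<subseteq> ?C" using c0 u u0 by blast
    show "?C \<subseteq> {c}" using par by blast
  qed
  have "?E c = span {u}"
  proof
    show "?E c \<subseteq> span {u}"
    proof
      fix w assume "w \<in> ?E c"
      then show "w \<in> span {u}" using par[of w c] c0 by (cases "w = 0") (auto simp: span_zero)
    qed
    show "span {u} \<subseteq> ?E c"
      by (rule span_minimal[OF _ sub]) (use u in auto)
  qed
  moreover have "dim (span {u}) = 1" using u0 by simp
  ultimately show ?thesis unfolding num_pos_eigenvalues_def C by simp
qed

section \<open>Directional derivatives of forms\<close>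

text \<open>
  Forms are presented as \<open>\<Sum>\<^sub>i x\<^sub>i g\<^sub>i\<close> with \<open>g\<^sub>i\<close> of one degree less, instead of
  by coefficients. The product rule then reads
  \<open>D\<^sub>a (\<Sum>\<^sub>i x\<^sub>i g\<^sub>i) = \<Sum>\<^sub>i a\<^sub>i g\<^sub>i + \<Sum>\<^sub>i x\<^sub>i D\<^sub>a g\<^sub>i\<close>, from which the
  degree, Euler's identity and the symmetry of second derivatives follow by induction.
\<close>

inductive hform :: "nat \<Rightarrow> (real ^ 'n \<Rightarrow> real) \<Rightarrow> bool" where
  hform_const: "hform 0 (\<lambda>x. c)"
| hform_Suc: "(\<And>i. hform d (g i)) \<Longrightarrow> hform (Suc d) (\<lambda>x. \<Sum>i\<in>UNIV. x $ i * g i x)"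

lemma hform_0E:
  assumes "hform 0 f" obtains c where "f = (\<lambda>x. c)"
  using assms by (cases rule: hform.cases) auto

lemma hform_SucE:
  assumes "hform (Suc d) f"
  obtains g where "\<And>i. hform d (g i)" "f = (\<lambda>x. \<Sum>i\<in>UNIV. x $ i * g i x)"
  using assms by (cases rule: hform.cases) auto

lemma hform_zero: "hform d (\<lambda>x. 0)"
proof (induction d)
  case 0 show ?case by (rule hform_const)
next
  case (Suc d)
  then show ?case using hform_Suc[of d "\<lambda>i x. 0"] by simp
qed

lemma hform_add: "hform d f \<Longrightarrow> hform d g \<Longrightarrow> hform d (\<lambda>x. f x + g x)"
proof (induction d arbitrary: f g)
  case 0
  then show ?case by (auto elim!: hform_0E intro: hform_const)
next
  case (Suc d)
  obtain p where p: "\<And>i. hform d (p i)" "f = (\<lambda>x. \<Sum>i\<in>UNIV. x $ i * p i x)"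
    using hform_SucE[OF Suc.prems(1)] by metis
  obtain q where q: "\<And>i. hform d (q i)" "g = (\<lambda>x. \<Sum>i\<in>UNIV. x $ i * q i x)"
    using hform_SucE[OF Suc.prems(2)] by metis
  have "hform (Suc d) (\<lambda>x. \<Sum>i\<in>UNIV. x $ i * (p i x + q i x))"
    by (rule hform_Suc) (rule Suc.IH[OF p(1) q(1)])
  then show ?case by (simp add: p(2) q(2) sum.distrib distrib_left)
qed

lemma hform_cmult: "hform d f \<Longrightarrow> hform d (\<lambda>x. c * f x)"
proof (induction d arbitrary: f)
  case 0
  then show ?case by (auto elim!: hform_0E intro: hform_const)
next
  case (Suc d)
  obtain p where p: "\<And>i. hform d (p i)" "f = (\<lambda>x. \<Sum>i\<in>UNIV. x $ i * p i x)"
    using hform_SucE[OF Suc.prems(1)] by metis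
  have "hform (Suc d) (\<lambda>x. \<Sum>i\<in>UNIV. x $ i * (c * p i x))"
    by (rule hform_Suc) (rule Suc.IH[OF p(1)])
  then show ?case by (simp add: p(2) sum_distrib_left mult.left_commute)
qed

lemma hform_sum:
  assumes "\<And>i. i \<in> I \<Longrightarrow> hform d (g i)"
  shows "hform d (\<lambda>x. \<Sum>i\<in>I. c i * g i x)"
proof (cases "finite I")
  case True
  then show ?thesis using assms
    by (induction rule: finite_induct) (auto intro!: hform_zero hform_add hform_cmult)
qed (simp add: hform_zero)

text \<open>
  Splitting off one variable that occurs in the monomial lowers its degree by one.
\<close>

lemma hform_monomial:
  fixes \<alpha> :: "'n::finite \<Rightarrow> nat"
  assumes "(\<Sum>i\<in>UNIV. \<alpha> i) = d"
  shows "hform d (\<lambda>x :: real ^ 'n. \<Prod>i\<in>UNIV. (x $ i) ^ \<alpha> i)"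
  using assms
proof (induction d arbitrary: \<alpha>)
  case 0
  then show ?case using hform_const[of 1] by simp
next
  case (Suc d)
  have "\<exists>k. \<alpha> k \<noteq> 0"
  proof (rule ccontr)
    assume "\<nexists>k. \<alpha> k \<noteq> 0"
    then have "(\<Sum>i\<in>UNIV. \<alpha> i) = 0" by simp
    then show False using Suc.prems by simp
  qed
  then obtain k where k: "\<alpha> k \<noteq> 0" by blast
  define \<beta> where "\<beta> = \<alpha>(k := \<alpha> k - 1)"
  have off: "\<And>i. i \<noteq> k \<Longrightarrow> \<beta> i = \<alpha> i" and on: "\<alpha> k = Suc (\<beta> k)"
    using k by (auto simp: \<beta>_def)
  have "(\<Sum>i\<in>UNIV. \<alpha> i) = \<alpha> k + (\<Sum>i\<in>UNIV - {k}. \<alpha> i)"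
    by (simp add: sum.remove)
  moreover have "(\<Sum>i\<in>UNIV. \<beta> i) = \<beta> k + (\<Sum>i\<in>UNIV - {k}. \<alpha> i)"
    using off by (simp add: sum.remove[of UNIV k])
  ultimately have \<beta>: "(\<Sum>i\<in>UNIV. \<beta> i) = d" using Suc.prems on by simp
  have eq: "(\<Prod>i\<in>UNIV. (x $ i) ^ \<alpha> i) = x $ k * (\<Prod>i\<in>UNIV. (x $ i) ^ \<beta> i)" for x :: "real ^ 'n"
    using off on by (simp add: prod.remove[of UNIV k])
  define g where "g = (\<lambda>i. if i = k then (\<lambda>x :: real ^ 'n. \<Prod>i\<in>UNIV. (x $ i) ^ \<beta> i) else (\<lambda>x. 0))"
  have "hform (Suc d) (\<lambda>x. \<Sum>i\<in>UNIV. x $ i * g i x)"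
    by (rule hform_Suc) (simp add: g_def hform_zero Suc.IH[OF \<beta>])
  moreover have "(\<Sum>i\<in>UNIV. x $ i * g i x) = (\<Prod>i\<in>UNIV. (x $ i) ^ \<alpha> i)" for x
    unfolding eq g_def by (simp add: if_distrib[of "\<lambda>h. x $ _ * h x"] cong: if_cong)
  ultimately show ?case by simp
qed

lemma forms_imp_hform: "f \<in> forms d \<Longrightarrow> hform d f"
  unfolding forms_def by (auto intro!: hform_sum hform_monomial)

lemma hform_has_partial_deriv:
  fixes f :: "real ^ 'n \<Rightarrow> real"
  assumes "hform d f"
  shows "((\<lambda>t. f (x + t *\<^sub>R axis i 1)) has_real_derivative partial_deriv i f x) (at 0)"
proof -
  have "\<exists>D. ((\<lambda>t. f (x + t *\<^sub>R axis i 1)) has_real_derivative D) (at 0)"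
    using assms
  proof (induction rule: hform.induct)
    case (hform_const c)
    show ?case by (auto intro!: exI derivative_eq_intros)
  next
    case (hform_Suc d g)
    then obtain D where D: "\<And>j. ((\<lambda>t. g j (x + t *\<^sub>R axis i 1)) has_real_derivative D j) (at 0)"
      by metis
    have "((\<lambda>t. (x + t *\<^sub>R axis i 1) $ j) has_real_derivative axis i 1 $ j) (at 0)" for j
      by (auto intro!: derivative_eq_intros)
    then show ?case by (intro exI) (rule DERIV_sum, rule DERIV_mult, assumption, rule D)
  qed
  then show ?thesis unfolding partial_deriv_def by (metis DERIV_imp_deriv)
qed

lemma partial_derivI:
  "((\<lambda>t. f (x + t *\<^sub>R axis i 1)) has_real_derivative D) (at 0) \<Longrightarrow> partial_deriv i f x = D"
  unfolding partial_deriv_def by (rule DERIV_imp_deriv)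

lemma partial_deriv_eq_dir_deriv: "partial_deriv i f = dir_deriv (axis i 1) f"
  by (rule ext) (simp add: dir_deriv_def axis_def if_distrib[of "\<lambda>a. a * _"] cong: if_cong)

lemma dir_deriv_const: "dir_deriv a (\<lambda>x. c) = (\<lambda>x. 0)"
  by (rule ext) (simp add: dir_deriv_def partial_deriv_def)

lemma dir_deriv_sum:
  fixes g :: "'i \<Rightarrow> real ^ 'n \<Rightarrow> real"
  assumes "\<And>i. i \<in> I \<Longrightarrow> hform d (g i)"
  shows "dir_deriv a (\<lambda>x. \<Sum>i\<in>I. c i * g i x) = (\<lambda>x. \<Sum>i\<in>I. c i * dir_deriv a (g i) x)"
proof
  fix x
  have "partial_deriv k (\<lambda>x. \<Sum>i\<in>I. c i * g i x) x = (\<Sum>i\<in>I. c i * partial_deriv k (g i) x)" for k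
    by (rule partial_derivI, rule DERIV_sum, rule DERIV_cmult, rule hform_has_partial_deriv[OF assms])
  then show "dir_deriv a (\<lambda>x. \<Sum>i\<in>I. c i * g i x) x = (\<Sum>i\<in>I. c i * dir_deriv a (g i) x)"
    unfolding dir_deriv_def
    by (simp add: sum_distrib_left) (subst sum.swap, simp add: mult.left_commute)
qed

lemma dir_deriv_add:
  assumes "hform d f" "hform d g"
  shows "dir_deriv a (\<lambda>x. f x + g x) = (\<lambda>x. dir_deriv a f x + dir_deriv a g x)"
  using dir_deriv_sum[of UNIV d "\<lambda>b. if b then f else g" a "\<lambda>_. 1"] assms
  by (simp add: UNIV_bool add.commute)

lemma dir_deriv_Suc:
  fixes g :: "'n \<Rightarrow> real ^ 'n \<Rightarrow> real"
  assumes "\<And>i. hform d (g i)"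
  shows "dir_deriv a (\<lambda>x. \<Sum>i\<in>UNIV. x $ i * g i x)
           = (\<lambda>x. (\<Sum>i\<in>UNIV. a $ i * g i x) + (\<Sum>i\<in>UNIV. x $ i * dir_deriv a (g i) x))"
proof
  fix x
  have "partial_deriv k (\<lambda>x. \<Sum>i\<in>UNIV. x $ i * g i x) x
          = g k x + (\<Sum>i\<in>UNIV. x $ i * partial_deriv k (g i) x)" for k
  proof (rule partial_derivI)
    have *: "((\<lambda>t. (x + t *\<^sub>R axis k 1) $ i * g i (x + t *\<^sub>R axis k 1)) has_real_derivative
        (if i = k then g i x else 0) + x $ i * partial_deriv k (g i) x) (at 0)" for i
    proof -
      have "((\<lambda>t. (x + t *\<^sub>R axis k 1) $ i) has_real_derivative (if i = k then 1 else 0)) (at 0)"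
        by (auto intro!: derivative_eq_intros simp: axis_def)
      from DERIV_mult[OF this hform_has_partial_deriv[OF assms]] show ?thesis
        by (rule DERIV_cong) (simp add: mult.commute)
    qed
    show "((\<lambda>t. \<Sum>i\<in>UNIV. (x + t *\<^sub>R axis k 1) $ i * g i (x + t *\<^sub>R axis k 1)) has_real_derivative
        g k x + (\<Sum>i\<in>UNIV. x $ i * partial_deriv k (g i) x)) (at 0)"
      by (rule DERIV_cong[OF DERIV_sum[OF *]]) (simp add: sum.distrib)
  qed
  then have "dir_deriv a (\<lambda>x. \<Sum>i\<in>UNIV. x $ i * g i x) x = (\<Sum>k\<in>UNIV. a $ k * g k x)
      + (\<Sum>k\<in>UNIV. \<Sum>i\<in>UNIV. a $ k * (x $ i * partial_deriv k (g i) x))"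
    unfolding dir_deriv_def by (simp add: distrib_left sum.distrib sum_distrib_left)
  also have "(\<Sum>k\<in>UNIV. \<Sum>i\<in>UNIV. a $ k * (x $ i * partial_deriv k (g i) x))
      = (\<Sum>i\<in>UNIV. x $ i * dir_deriv a (g i) x)"
    by (subst sum.swap) (simp add: dir_deriv_def sum_distrib_left mult.left_commute)
  finally show "dir_deriv a (\<lambda>x. \<Sum>i\<in>UNIV. x $ i * g i x) x
      = (\<Sum>i\<in>UNIV. a $ i * g i x) + (\<Sum>i\<in>UNIV. x $ i * dir_deriv a (g i) x)" .
qed

lemma hform_dir_deriv: "hform d f \<Longrightarrow> hform (d - 1) (dir_deriv a f)"
proof (induction rule: hform.induct)
  case (hform_const c)
  then show ?case by (simp add: dir_deriv_const hform_zero)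
next
  case (hform_Suc d g)
  have "hform d (\<lambda>x. \<Sum>i\<in>UNIV. x $ i * dir_deriv a (g i) x)"
  proof (cases d)
    case 0
    then have "dir_deriv a (g i) = (\<lambda>x. 0)" for i
      using hform_Suc.hyps[of i] by (auto elim!: hform_0E simp: dir_deriv_const)
    then show ?thesis by (simp add: hform_zero)
  next
    case (Suc d')
    then show ?thesis using hform_Suc.IH by (auto intro: hform.hform_Suc)
  qed
  then show ?case
    using hform_Suc.hyps by (simp add: dir_deriv_Suc[OF hform_Suc.hyps] hform_add hform_sum)
qed

lemma Euler_identity: "hform d f \<Longrightarrow> dir_deriv x f x = real d * f x"
proof (induction rule: hform.induct)
  case (hform_Suc d g)
  then show ?case
    by (simp add: dir_deriv_Suc[OF hform_Suc.hyps] distrib_left distrib_right sum.distrib sum_distrib_left mult.left_commute)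
qed (simp add: dir_deriv_const)

lemma dir_deriv_commute: "hform d f \<Longrightarrow> dir_deriv a (dir_deriv b f) = dir_deriv b (dir_deriv a f)"
proof (induction rule: hform.induct)
  case (hform_Suc d g)
  have twice: "dir_deriv a (dir_deriv b (\<lambda>x. \<Sum>i\<in>UNIV. x $ i * g i x)) =
      (\<lambda>x. (\<Sum>i\<in>UNIV. b $ i * dir_deriv a (g i) x) + ((\<Sum>i\<in>UNIV. a $ i * dir_deriv b (g i) x)
        + (\<Sum>i\<in>UNIV. x $ i * dir_deriv a (dir_deriv b (g i)) x)))" for a b
  proof (cases d)
    case 0
    then have "dir_deriv c (g i) = (\<lambda>x. 0)" for c i
      using hform_Suc.hyps[of i] by (auto elim!: hform_0E simp: dir_deriv_const)
    then show ?thesis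
      using dir_deriv_sum[of UNIV d g a "($) b"] hform_Suc.hyps
      by (simp add: dir_deriv_Suc[OF hform_Suc.hyps] dir_deriv_const)
  next
    case (Suc d')
    have h: "hform d' (dir_deriv b (g i))" for i
      using hform_dir_deriv[OF hform_Suc.hyps] Suc by simp
    have "dir_deriv a (dir_deriv b (\<lambda>x. \<Sum>i\<in>UNIV. x $ i * g i x)) =
      (\<lambda>x. dir_deriv a (\<lambda>x. \<Sum>i\<in>UNIV. b $ i * g i x) x
         + dir_deriv a (\<lambda>x. \<Sum>i\<in>UNIV. x $ i * dir_deriv b (g i) x) x)"
      unfolding dir_deriv_Suc[OF hform_Suc.hyps]
      by (rule dir_deriv_add[of d]) (use h Suc hform_Suc.hyps in \<open>auto intro: hform_sum hform.hform_Suc\<close>)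
    then show ?thesis by (simp add: dir_deriv_sum[OF hform_Suc.hyps] dir_deriv_Suc[OF h])
  qed
  show ?case unfolding twice using hform_Suc.IH by (simp add: add.left_commute)
qed (simp add: dir_deriv_const)

lemma dir_derivs_simps [simp]:
  "dir_derivs [] f = f"
  "dir_derivs (a # as) f = dir_deriv a (dir_derivs as f)"
  "dir_derivs (as @ bs) f = dir_derivs as (dir_derivs bs f)"
  by (simp_all add: dir_derivs_def)

lemma dir_derivs_zero: "dir_derivs as (\<lambda>x. 0) = (\<lambda>x. 0)"
  by (induction as) (simp_all add: dir_deriv_const)

lemma hform_dir_derivs: "hform d f \<Longrightarrow> hform (d - length as) (dir_derivs as f)"
proof (induction as)
  case (Cons a as)
  then show ?case using hform_dir_deriv[of "d - length as" "dir_derivs as f" a] by simp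
qed simp

lemma dir_deriv_dir_derivs:
  assumes "hform d f"
  shows "dir_derivs as (dir_deriv a f) = dir_deriv a (dir_derivs as f)"
proof (induction as)
  case (Cons b as)
  then show ?case using dir_deriv_commute[OF hform_dir_derivs[OF assms]] by simp
qed simp

text \<open>
  The polarization formula: the form is recovered from its mixed values on the diagonal. The
  derivatives exhaust the degree, so the point \<open>y\<close> of evaluation is arbitrary.
\<close>

lemma dir_derivs_replicate:
  "hform k f \<Longrightarrow> dir_derivs (replicate k x) f y = fact k * f x"
proof (induction k arbitrary: f)
  case 0
  then show ?case by (auto elim!: hform_0E)
next
  case (Suc k)
  have "dir_derivs (replicate (Suc k) x) f y = dir_derivs (replicate k x) (dir_deriv x f) y"
    using dir_deriv_dir_derivs[OF Suc.prems] by simp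
  also have "\<dots> = fact k * dir_deriv x f x"
    using Suc.IH hform_dir_deriv[OF Suc.prems] by simp
  finally show ?case using Euler_identity[OF Suc.prems, of x] by simp
qed

lemma dir_derivs_const_point:
  assumes "hform (length as) f"
  shows "dir_derivs as f x = dir_derivs as f y"
  using hform_dir_derivs[OF assms, of as] by (auto elim!: hform_0E)

lemma dir_deriv_linear: "dir_deriv (a + s *\<^sub>R b) f x = dir_deriv a f x + s * dir_deriv b f x"
  by (simp add: dir_deriv_def distrib_right sum.distrib sum_distrib_left mult.assoc)

lemma dir_derivs_sum:
  assumes "\<And>i. i \<in> I \<Longrightarrow> hform d (g i)"
  shows "dir_derivs as (\<lambda>x. \<Sum>i\<in>I. c i * g i x) = (\<lambda>x. \<Sum>i\<in>I. c i * dir_derivs as (g i) x)"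
proof (induction as)
  case (Cons a as)
  then show ?case
    by (simp add: dir_deriv_sum[OF hform_dir_derivs[OF assms]])
qed simp

lemma dir_deriv_expand: "dir_deriv a f = (\<lambda>x. \<Sum>i\<in>UNIV. a $ i * dir_deriv (axis i 1) f x)"
  by (rule ext) (simp add: dir_deriv_def flip: partial_deriv_eq_dir_deriv)

text \<open>
  Mixed derivatives are multilinear in their directions, hence continuous in them. This carries
  inequalities from directions \<open>b + t e\<close> in the interior of a cone to directions \<open>b\<close> on its
  boundary.
\<close>

lemma tendsto_dir_derivs_shift:
  fixes f :: "real ^ 'n \<Rightarrow> real"
  assumes "hform d f"
  shows "((\<lambda>t. dir_derivs (map (\<lambda>b. b + t *\<^sub>R e) bs) f x) \<longlongrightarrow> dir_derivs bs f x) (at_right 0)"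
  using assms
proof (induction bs arbitrary: f d)
  case (Cons b bs)
  have split_head: "dir_derivs (a # as) f x
      = (\<Sum>j\<in>UNIV. a $ j * dir_derivs as (dir_deriv (axis j 1) f) x)" for a as
  proof -
    have "dir_derivs (a # as) f = dir_derivs as (dir_deriv a f)"
      using dir_deriv_dir_derivs[OF Cons.prems] by simp
    also have "\<dots> = dir_derivs as (\<lambda>x. \<Sum>j\<in>UNIV. a $ j * dir_deriv (axis j 1) f x)"
      by (subst dir_deriv_expand) simp
    finally show ?thesis by (simp add: dir_derivs_sum[OF hform_dir_deriv[OF Cons.prems]])
  qed
  have "((\<lambda>t. (b + t *\<^sub>R e) $ j) \<longlongrightarrow> b $ j) (at_right 0)" for j
    by (auto intro!: tendsto_eq_intros)
  then show ?case
    unfolding list.map split_head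
    by (intro tendsto_sum tendsto_mult Cons.IH[OF hform_dir_deriv[OF Cons.prems]])
qed simp

section \<open>Hessians\<close>

lemma hessian_eq_dir_deriv: "hessian f x = (\<chi> i j. dir_deriv (axis i 1) (dir_deriv (axis j 1) f) x)"
  by (simp add: hessian_def partial_deriv_eq_dir_deriv)

lemma hessian_symmetric: "hform d f \<Longrightarrow> transpose (hessian f x) = hessian f x"
  using dir_deriv_commute[of d f]
  by (simp add: hessian_eq_dir_deriv transpose_def vec_eq_iff)

lemma inner_matrix_vector: "u \<bullet> (A *v v) = (\<Sum>i\<in>UNIV. \<Sum>j\<in>UNIV. u $ i * (v $ j * A $ i $ j))"
  for A :: "real ^ 'n ^ 'n"
  by (simp add: inner_vec_def matrix_vector_mult_def sum_distrib_left mult.commute)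

lemma dir_deriv_twice:
  assumes "hform d f"
  shows "dir_deriv u (dir_deriv v f) x = u \<bullet> (hessian f x *v v)"
proof -
  have "dir_deriv u (dir_deriv v f) x
      = (\<Sum>i\<in>UNIV. u $ i * dir_deriv (axis i 1) (\<lambda>x. \<Sum>j\<in>UNIV. v $ j * dir_deriv (axis j 1) f x) x)"
    by (subst dir_deriv_expand, subst dir_deriv_expand[of v]) simp
  then show ?thesis
    by (simp add: dir_deriv_sum[OF hform_dir_deriv[OF assms]] inner_matrix_vector
        hessian_eq_dir_deriv sum_distrib_left)
qed

lemma hessian_ln:
  fixes f :: "real ^ 'n \<Rightarrow> real"
  assumes f: "hform d f" and pos: "f x > 0"
  shows "hessian (\<lambda>x. ln (f x)) x $ i $ j
           = hessian f x $ i $ j / f x - partial_deriv i f x * partial_deriv j f x / (f x)\<^sup>2"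
proof -
  have ln1: "partial_deriv k (\<lambda>x. ln (f x)) y = partial_deriv k f y / f y" if "f y > 0" for k y
    by (rule partial_derivI)
      (rule derivative_eq_intros hform_has_partial_deriv[OF f] refl | use that in simp)+
  have h1: "hform (d - 1) (partial_deriv j f)"
    unfolding partial_deriv_eq_dir_deriv by (rule hform_dir_deriv[OF f])
  have "isCont (\<lambda>t. f (x + t *\<^sub>R axis i 1)) 0"
    by (rule DERIV_isCont[OF hform_has_partial_deriv[OF f]])
  then have "\<forall>\<^sub>F t in at 0. f (x + t *\<^sub>R axis i 1) > 0"
    using pos order_tendstoD(1) unfolding isCont_def by fastforce
  then have ev: "\<forall>\<^sub>F t in nhds 0. f (x + t *\<^sub>R axis i 1) > 0"
    using pos by (simp add: eventually_nhds_conv_at)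
  have "partial_deriv i (partial_deriv j (\<lambda>x. ln (f x))) x
      = deriv (\<lambda>t. partial_deriv j f (x + t *\<^sub>R axis i 1) / f (x + t *\<^sub>R axis i 1)) 0"
    unfolding partial_deriv_def[of i]
    by (rule deriv_cong_ev) (auto intro: eventually_mono[OF ev] simp: ln1)
  also have "\<dots> = (partial_deriv i (partial_deriv j f) x * f x
                    - partial_deriv j f x * partial_deriv i f x) / (f x * f x)"
    by (rule DERIV_imp_deriv)
      (rule derivative_eq_intros hform_has_partial_deriv[OF f] hform_has_partial_deriv[OF h1] refl
        | use pos in simp)+
  finally show ?thesis
    using pos by (simp add: hessian_def power2_eq_square diff_divide_distrib mult.commute)
qed

text \<open>
  With \<open>g = ln f\<close> one has
  \<open>D\<^sub>v D\<^sub>v g = D\<^sub>v D\<^sub>v f / f - (D\<^sub>v f)\<^sup>2 / f\<^sup>2\<close>, and multiplying by \<open>f\<^sup>2\<close> clears the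
  denominators.
\<close>

lemma log_concave_at_iff:
  fixes f :: "real ^ 'n \<Rightarrow> real"
  assumes f: "hform d f" and pos: "f x > 0"
  shows "log_concave_at f x \<longleftrightarrow> (\<forall>v. dir_deriv v (dir_deriv v f) x * f x \<le> (dir_deriv v f x)\<^sup>2)"
proof -
  let ?H = "hessian (\<lambda>x. ln (f x)) x"
  have sym: "transpose ?H = ?H"
    using hessian_symmetric[OF f, of x]
    by (simp add: vec_eq_iff transpose_def hessian_ln[OF f pos] mult.commute)
  have quad: "v \<bullet> (?H *v v) = dir_deriv v (dir_deriv v f) x / f x - (dir_deriv v f x)\<^sup>2 / (f x)\<^sup>2" for v
  proof -
    have "v \<bullet> (?H *v v) = (\<Sum>i\<in>UNIV. \<Sum>j\<in>UNIV. v $ i * (v $ j * hessian f x $ i $ j)) / f x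
        - (\<Sum>i\<in>UNIV. \<Sum>j\<in>UNIV. v $ i * partial_deriv i f x * (v $ j * partial_deriv j f x)) / (f x)\<^sup>2"
      by (simp add: inner_matrix_vector hessian_ln[OF f pos] right_diff_distrib sum_subtractf
          sum_divide_distrib mult_ac)
    also have "(\<Sum>i\<in>UNIV. \<Sum>j\<in>UNIV. v $ i * partial_deriv i f x * (v $ j * partial_deriv j f x))
        = (dir_deriv v f x)\<^sup>2"
      by (simp add: dir_deriv_def power2_eq_square sum_product)
    finally show ?thesis by (simp add: dir_deriv_twice[OF f] inner_matrix_vector)
  qed
  have "v \<bullet> (?H *v v) \<le> 0 \<longleftrightarrow> dir_deriv v (dir_deriv v f) x * f x \<le> (dir_deriv v f x)\<^sup>2" for v
    unfolding quad using pos by (simp add: field_simps power2_eq_square)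
  moreover have "f \<noteq> (\<lambda>x. 0)" using pos by auto
  ultimately show ?thesis
    unfolding log_concave_at_def neg_semidefinite_def using sym pos by simp
qed

text \<open>
  The matrix of a quadratic form is half its Hessian, whence the factor 2 in the bilinear form.
\<close>

lemma quad_matrix_hform:
  assumes q: "hform 2 q"
  shows "transpose (quad_matrix q) = quad_matrix q"
    and "dir_deriv u (dir_deriv v q) x = 2 * (u \<bullet> (quad_matrix q *v v))"
proof -
  let ?Q = "(1 / 2) *\<^sub>R hessian q 0"
  have bil: "dir_deriv u (dir_deriv v q) x = 2 * (u \<bullet> (?Q *v v))" for u v x
  proof -
    have "hform 0 (dir_deriv u (dir_deriv v q))"
      using hform_dir_derivs[OF q, of "[u, v]"] by simp
    then have "dir_deriv u (dir_deriv v q) x = dir_deriv u (dir_deriv v q) 0"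
      by (auto elim!: hform_0E)
    then show ?thesis by (simp add: dir_deriv_twice[OF q] scaleR_matrix_vector_assoc[symmetric])
  qed
  have sym: "transpose ?Q = ?Q"
    using hessian_symmetric[OF q, of 0] by (simp add: transpose_def vec_eq_iff)
  have "q x = x \<bullet> (?Q *v x)" for x
    using dir_derivs_replicate[OF q, of x 0] bil[of x x 0] by (simp add: numeral_2_eq_2)
  then have Q: "quad_matrix q = ?Q" by (rule quad_matrix_eq[OF sym])
  show "transpose (quad_matrix q) = quad_matrix q"
    and "dir_deriv u (dir_deriv v q) x = 2 * (u \<bullet> (quad_matrix q *v v))"
    unfolding Q using sym bil by auto
qed

section \<open>Positivity on a cone\<close>

text \<open>
  The translate \<open>a + t (interior K)\<close> is an open subset of \<open>K\<close>.
\<close>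

lemma interior_cone_add:
  fixes K :: "'a :: real_normed_vector set"
  assumes K: "convex_cone K" and "a \<in> K" "e \<in> interior K" "0 < t"
  shows "a + t *\<^sub>R e \<in> interior K"
proof -
  let ?U = "(\<lambda>y. a + y) ` ((\<lambda>y. t *\<^sub>R y) ` interior K)"
  have "open ?U" using \<open>0 < t\<close> by (intro open_translation open_scaling) auto
  moreover have "?U \<subseteq> K"
    using assms interior_subset[of K] by (auto intro!: convex_cone_add convex_cone_scaleR)
  ultimately have "?U \<subseteq> interior K" by (rule interior_maximal[rotated])
  then show ?thesis using \<open>e \<in> interior K\<close> by blast
qed

lemma interior_absorbs:
  fixes b c :: "'a :: real_normed_vector"
  assumes "b \<in> interior K"
  obtains s where "s > 0" "b + s *\<^sub>R c \<in> K" "b + (- s) *\<^sub>R c \<in> K"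
proof -
  obtain r where r: "r > 0" "cball b r \<subseteq> K"
    using assms by (auto simp: mem_interior_cball)
  define s where "s = r / (norm c + 1)"
  have "norm c + 1 > 0" by (smt (verit) norm_ge_zero)
  then have s: "s > 0" "s * norm c \<le> r"
    using r by (auto simp: s_def field_simps)
  then have "b + s *\<^sub>R c \<in> cball b r" "b + (- s) *\<^sub>R c \<in> cball b r"
    by (simp_all add: dist_norm)
  then show thesis using that s r by blast
qed

definition mixed_nonneg :: "(real ^ 'n) set \<Rightarrow> nat \<Rightarrow> (real ^ 'n \<Rightarrow> real) \<Rightarrow> bool" where
  "mixed_nonneg K d f \<longleftrightarrow>
     (\<forall>bs. length bs = d \<and> set bs \<subseteq> K \<longrightarrow> dir_derivs bs f 0 \<ge> 0)"

lemma mixed_nonneg_dir_derivs: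
  assumes "mixed_nonneg K d f" "set as \<subseteq> K" "length as \<le> d"
  shows "mixed_nonneg K (d - length as) (dir_derivs as f)"
  unfolding mixed_nonneg_def
proof (intro allI impI)
  fix bs assume "length bs = d - length as \<and> set bs \<subseteq> K"
  then show "dir_derivs bs (dir_derivs as f) 0 \<ge> 0"
    using assms(1)[unfolded mixed_nonneg_def, rule_format, of "bs @ as"] assms(2,3) by simp
qed

text \<open>
  Fix all directions but the first. The mixed value is linear in the first one, nonnegative on
  \<open>K\<close> and zero at an interior point, so it vanishes identically. In particular the form
  \<open>D\<^sub>c f\<close>, for each \<open>c \<in> K\<close>, satisfies the hypotheses with the remaining directions and is
  zero by induction. As \<open>K\<close> spans the space, all derivatives of \<open>f\<close> vanish, and Euler's
  identity gives \<open>f = 0\<close>.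
\<close>

lemma eq_zero_if_mixed_zero:
  assumes "hform d f" "mixed_nonneg K d f"
    and "length bs = d" "set bs \<subseteq> interior K" "dir_derivs bs f 0 = 0"
  shows "f = (\<lambda>x. 0)"
  using assms
proof (induction d arbitrary: f bs)
  case 0
  then show ?case by (auto elim!: hform_0E)
next
  case (Suc d)
  from Suc.prems(3) obtain b bs' where bs: "bs = b # bs'" "length bs' = d"
    by (auto simp: length_Suc_conv)
  have b: "b \<in> interior K" and bs': "set bs' \<subseteq> interior K" using Suc.prems(4) bs by auto
  have nonneg: "0 \<le> dir_derivs (c # as) f 0" if "c \<in> K" "length as = d" "set as \<subseteq> K" for c as
    using Suc.prems(2)[unfolded mixed_nonneg_def, rule_format, of "c # as"] that by simp
  have any: "dir_derivs (c # bs') f 0 = 0" for c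
  proof -
    obtain s where s: "s > 0" "b + s *\<^sub>R c \<in> K" "b + (- s) *\<^sub>R c \<in> K"
      using interior_absorbs[OF b] by metis
    have zero: "dir_deriv b (dir_derivs bs' f) 0 = 0" using Suc.prems(5) bs by simp
    have sub: "set bs' \<subseteq> K" using bs' interior_subset by blast
    from nonneg[OF s(2) bs(2) sub] nonneg[OF s(3) bs(2) sub]
    have "s * dir_deriv c (dir_derivs bs' f) 0 = 0"
      using zero by (simp only: dir_derivs_simps dir_deriv_linear)
    then show ?thesis using s by simp
  qed
  have onK: "dir_deriv c f = (\<lambda>x. 0)" if c: "c \<in> K" for c
  proof (rule Suc.IH[OF _ _ bs(2) bs'])
    show "hform d (dir_deriv c f)" using hform_dir_deriv[OF Suc.prems(1)] by simp
    show "mixed_nonneg K d (dir_deriv c f)"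
      using mixed_nonneg_dir_derivs[OF Suc.prems(2), of "[c]"] c by simp
    show "dir_derivs bs' (dir_deriv c f) 0 = 0"
      using any[of c] by (simp add: dir_deriv_dir_derivs[OF Suc.prems(1)])
  qed
  show ?case
  proof
    fix x
    obtain s where s: "s > 0" "b + s *\<^sub>R x \<in> K"
      using interior_absorbs[OF b] by metis
    have "b \<in> K" using b interior_subset by blast
    from onK[OF s(2)] onK[OF this] have "dir_deriv x f x = 0"
      using s(1) dir_deriv_linear[of b s x f x] by simp
    then show "f x = 0" using Euler_identity[OF Suc.prems(1), of x] by simp
  qed
qed

lemma mixed_pos_interior:
  assumes "hform d f" "mixed_nonneg K d f" "f \<noteq> (\<lambda>x. 0)"
    and "length bs = d" "set bs \<subseteq> interior K"
  shows "dir_derivs bs f 0 > 0"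
proof -
  have "set bs \<subseteq> K" using assms(5) interior_subset by blast
  then have "dir_derivs bs f 0 \<ge> 0" using assms(2,4) by (simp add: mixed_nonneg_def)
  moreover have "dir_derivs bs f 0 \<noteq> 0" using eq_zero_if_mixed_zero assms by blast
  ultimately show ?thesis by simp
qed

lemma mixed_nonneg_imp_nonneg:
  assumes "hform d f" "mixed_nonneg K d f" "x \<in> K"
  shows "f x \<ge> 0"
proof -
  have "0 \<le> dir_derivs (replicate d x) f 0"
    using assms(2)[unfolded mixed_nonneg_def, rule_format, of "replicate d x"] assms(3)
    by (simp add: set_replicate_conv_if)
  then show ?thesis
    unfolding dir_derivs_replicate[OF assms(1)] by (smt (verit) fact_gt_zero mult_pos_neg)
qed

lemma pos_on_interior:
  assumes "hform d f" "mixed_nonneg K d f" "f \<noteq> (\<lambda>x. 0)" "x \<in> interior K"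
  shows "f x > 0"
proof -
  have "0 < dir_derivs (replicate d x) f 0"
    using mixed_pos_interior[OF assms(1-3), of "replicate d x"] assms(4)
    by (simp add: set_replicate_conv_if)
  then show ?thesis by (simp add: dir_derivs_replicate[OF assms(1)] zero_less_mult_iff)
qed

section \<open>The Alexandrov-Fenchel inequality\<close>

text \<open>
  For mixed volumes, with \<open>f\<close> the volume polynomial, this is the classical
  Alexandrov-Fenchel inequality. The vector \<open>v\<close> is arbitrary, so \<open>x\<close> and the remaining
  directions carry all of the positivity.
\<close>

definition alexandrov_fenchel :: "(real ^ 'n) set \<Rightarrow> nat \<Rightarrow> (real ^ 'n \<Rightarrow> real) \<Rightarrow> bool" where
  "alexandrov_fenchel K d f \<longleftrightarrow>
     (\<forall>cs v x. length cs + 2 = d \<and> set cs \<subseteq> K \<and> x \<in> K \<longrightarrow>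
        dir_derivs (v # v # cs) f 0 * dir_derivs (x # x # cs) f 0 \<le> (dir_derivs (v # x # cs) f 0)\<^sup>2)"

text \<open>
  Let \<open>g\<close> be a derivative of \<open>f\<close> of degree \<open>k = m + 2\<close>. With all spare directions equal
  to \<open>x\<close>, the three mixed values in the Alexandrov-Fenchel inequality are \<open>m! D\<^sub>v D\<^sub>v g(x)\<close>,
  \<open>(m + 2)! g(x)\<close> and \<open>(m + 1)! D\<^sub>v g(x)\<close>. After cancellation this reads
  \<open>(m + 2) g D\<^sub>v D\<^sub>v g \<le> (m + 1) (D\<^sub>v g)\<^sup>2\<close>, which is stronger than log-concavity of \<open>g\<close> at
  \<open>x\<close>. In degree at most one the second derivatives vanish.
\<close>

lemma completely_log_concave_if_alexandrov_fenchel: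
  assumes f: "hform d f" and nonneg: "mixed_nonneg K d f" and AF: "alexandrov_fenchel K d f"
  shows "completely_log_concave K d f"
  unfolding completely_log_concave_def
proof (intro allI impI ballI)
  fix as x assume as: "length as \<le> d \<and> set as \<subseteq> K" and x: "x \<in> interior K"
  have xK: "x \<in> K" using x interior_subset by blast
  define g where "g = dir_derivs as f"
  define k where "k = d - length as"
  have g: "hform k g" unfolding g_def k_def by (rule hform_dir_derivs[OF f])
  show "log_concave_at (dir_derivs as f) x"
  proof (cases "g = (\<lambda>x. 0)")
    case True
    then show ?thesis by (simp add: log_concave_at_def g_def)
  next
    case False
    have "mixed_nonneg K k g"
      unfolding g_def k_def using mixed_nonneg_dir_derivs[OF nonneg] as by blast
    then have pos: "g x > 0" using pos_on_interior[OF g _ False x] by simp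
    have "dir_deriv v (dir_deriv v g) x * g x \<le> (dir_deriv v g x)\<^sup>2" for v
    proof (cases "k \<le> 1")
      case True
      then have "hform 0 (dir_deriv v g)" using hform_dir_deriv[OF g, of v] by simp
      then show ?thesis by (auto elim!: hform_0E simp: dir_deriv_const)
    next
      case False
      then obtain m where m: "k = Suc (Suc m)"
        by (metis One_nat_def not_less_eq_eq Suc_le_D)
      let ?cs = "replicate m x @ as"
      let ?T = "\<lambda>u v. dir_derivs (u # v # ?cs) f 0"
      have A: "?T v v = fact m * dir_deriv v (dir_deriv v g) x"
      proof -
        have h1: "hform (Suc m) (dir_deriv v g)" using hform_dir_deriv[OF g] m by simp
        have h2: "hform m (dir_deriv v (dir_deriv v g))" using hform_dir_deriv[OF h1] by simp
        show ?thesis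
          using dir_derivs_replicate[OF h2, of x 0]
          by (simp add: dir_deriv_dir_derivs[OF h1] dir_deriv_dir_derivs[OF g] flip: g_def)
      qed
      have C: "?T v x = fact (Suc m) * dir_deriv v g x"
      proof -
        have h1: "hform (Suc m) (dir_deriv v g)" using hform_dir_deriv[OF g] m by simp
        have "dir_derivs (replicate (Suc m) x) (dir_deriv v g)
                = dir_deriv v (dir_derivs (replicate (Suc m) x) g)"
          by (rule dir_deriv_dir_derivs[OF g])
        then show ?thesis
          using dir_derivs_replicate[OF h1, of x 0] by (simp flip: g_def)
      qed
      have B: "?T x x = fact (Suc (Suc m)) * g x"
        using dir_derivs_replicate[OF g, of x 0] m by (simp flip: g_def)
      have "length ?cs + 2 = d" using m as by (simp add: k_def)
      then have "?T v v * ?T x x \<le> (?T v x)\<^sup>2"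
        using AF[unfolded alexandrov_fenchel_def, rule_format, of ?cs x v] as xK
        by (simp add: set_replicate_conv_if)
      then have le: "fact m * dir_deriv v (dir_deriv v g) x * (fact (Suc (Suc m)) * g x)
          \<le> (fact (Suc m) * dir_deriv v g x)\<^sup>2"
        unfolding A B C .
      let ?a = "dir_deriv v (dir_deriv v g) x * g x" and ?c = "(dir_deriv v g x)\<^sup>2"
      have "((fact m)\<^sup>2 * (real m + 1)) * ((real m + 2) * ?a)
          \<le> ((fact m)\<^sup>2 * (real m + 1)) * ((real m + 1) * ?c)"
        using le by (simp add: power2_eq_square algebra_simps)
      then have "(real m + 2) * ?a \<le> (real m + 1) * ?c"
        by (rule mult_left_le_imp_le) simp
      then have "(real m + 1) * ?a \<le> (real m + 1) * ?c" if "?a > 0"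
        using that by (simp add: algebra_simps)
      then show ?thesis
        by (cases "?a > 0") (auto intro: order_trans[OF _ zero_le_power2])
    qed
    then show ?thesis using log_concave_at_iff[of k g x, OF g pos] by (simp flip: g_def)
  qed
qed

text \<open>
  In degree at least two both properties hold for interior directions, by the hypotheses on the
  matrices and the reversed Cauchy-Schwarz inequality. Moving every direction \<open>b\<close> to
  \<open>b + t e\<close> with \<open>e\<close> interior, and letting \<open>t\<close> tend to \<open>0\<close>, extends them to \<open>K\<close>.
  The arbitrary vector \<open>v\<close> may be moved along with the others.
\<close>

lemma lorentzian_imp_mixed_nonneg_alexandrov_fenchel:
  assumes K: "proper_cone K" and f: "hform d f" and lor: "lorentzian K d f"
  shows "mixed_nonneg K d f \<and> alexandrov_fenchel K d f"
proof -
  have cone: "convex_cone K" and "interior K \<noteq> {}"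
    using K by (auto simp: proper_cone_def)
  then obtain e where e: "e \<in> interior K" by blast
  consider "d = 0" | "d = 1" | "f = (\<lambda>x. 0)" | "d \<ge> 2" "f \<noteq> (\<lambda>x. 0)" by linarith
  then show ?thesis
  proof cases
    case 1
    have "0 \<in> K" using cone by (simp add: convex_cone_contains_0)
    then show ?thesis
      using 1 lor by (simp add: lorentzian_def mixed_nonneg_def alexandrov_fenchel_def)
  next
    case 2
    have "dir_derivs bs f 0 \<ge> 0" if bs: "length bs = d" "set bs \<subseteq> K" for bs
    proof -
      obtain b where b: "bs = [b]" using bs 2 by (auto simp: length_Suc_conv)
      then show ?thesis
        using dir_derivs_replicate[OF f, of b 0] lor bs 2 by (simp add: lorentzian_def)
    qed
    then show ?thesis using 2 by (simp add: mixed_nonneg_def alexandrov_fenchel_def)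
  next
    case 3
    have "dir_derivs bs f 0 = 0" for bs unfolding 3 dir_derivs_zero ..
    then show ?thesis
      unfolding mixed_nonneg_def alexandrov_fenchel_def by (simp del: dir_derivs_simps)
  next
    case 4
    have int: "0 < dir_derivs (x # y # cs) f 0"
        "dir_derivs (v # v # cs) f 0 * dir_derivs (x # x # cs) f 0 \<le> (dir_derivs (v # x # cs) f 0)\<^sup>2"
      if cs: "length cs + 2 = d" "set cs \<subseteq> interior K" and x: "x \<in> interior K" and y: "y \<in> interior K"
      for cs x y v
    proof -
      let ?Q = "quad_matrix (dir_derivs cs f)"
      have "d - length cs = 2" using cs by linarith
      then have "hform 2 (dir_derivs cs f)" using hform_dir_derivs[OF f, of cs] by simp
      note Q = quad_matrix_hform[OF this]
      have T: "dir_derivs (u # v # cs) f 0 = 2 * (u \<bullet> (?Q *v v))" for u v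
        using Q(2) by simp
      have one: "num_pos_eigenvalues ?Q = 1"
        and pos: "\<And>x y. x \<in> interior K \<Longrightarrow> y \<in> interior K \<Longrightarrow> y \<bullet> (?Q *v x) > 0"
        using lor 4 cs by (auto simp: lorentzian_def Let_def)
      show "0 < dir_derivs (x # y # cs) f 0" unfolding T using pos[OF y x] by simp
      show "dir_derivs (v # v # cs) f 0 * dir_derivs (x # x # cs) f 0 \<le> (dir_derivs (v # x # cs) f 0)\<^sup>2"
        unfolding T using reverse_Cauchy_Schwarz[OF Q(1) one pos[OF x x], of v]
        by (simp add: power_mult_distrib)
    qed
    define shift where "shift = (\<lambda>t b. b + t *\<^sub>R e)"
    have lim: "((\<lambda>t. dir_derivs (map (shift t) bs) f 0) \<longlongrightarrow> dir_derivs bs f 0) (at_right 0)" for bs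
      unfolding shift_def by (rule tendsto_dir_derivs_shift[OF f])
    have shift: "shift t b \<in> interior K" if "b \<in> K" "t > 0" for t b
      unfolding shift_def using interior_cone_add[OF cone _ e] that by blast
    have pos_ev: "\<forall>\<^sub>F t :: real in at_right 0. t > 0" by (rule eventually_at_right_less)
    have "mixed_nonneg K d f"
      unfolding mixed_nonneg_def
    proof (intro allI impI)
      fix bs assume bs: "length bs = d \<and> set bs \<subseteq> K"
      then obtain b c cs where bcs: "bs = b # c # cs"
        using 4 by (metis Suc_le_length_iff numeral_2_eq_2)
      have "0 \<le> dir_derivs (map (shift t) bs) f 0" if "t > 0" for t
      proof -
        have "set (map (shift t) cs) \<subseteq> interior K" using bs bcs shift that by auto
        then show ?thesis
          using int(1)[of "map (shift t) cs" "shift t b" "shift t c"] bs bcs that shift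
          by simp
      qed
      then show "0 \<le> dir_derivs bs f 0"
        by (intro tendsto_lowerbound[OF lim]) (auto intro: eventually_mono[OF pos_ev])
    qed
    moreover have "alexandrov_fenchel K d f"
      unfolding alexandrov_fenchel_def
    proof (intro allI impI)
      fix cs v x assume as: "length cs + 2 = d \<and> set cs \<subseteq> K \<and> x \<in> K"
      let ?T = "\<lambda>t u v. dir_derivs (map (shift t) (u # v # cs)) f 0"
      have "?T t v v * ?T t x x \<le> (?T t v x)\<^sup>2" if "t > 0" for t
      proof -
        have "set (map (shift t) cs) \<subseteq> interior K" using as shift that by auto
        then show ?thesis
          using int(2)[of "map (shift t) cs" "shift t x" "shift t x" "shift t v"] as that shift
          by simp
      qed
      then have "\<forall>\<^sub>F t in at_right 0. ?T t v v * ?T t x x \<le> (?T t v x)\<^sup>2"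
        by (intro eventually_mono[OF pos_ev]) blast
      then show "dir_derivs (v # v # cs) f 0 * dir_derivs (x # x # cs) f 0
          \<le> (dir_derivs (v # x # cs) f 0)\<^sup>2"
        by (rule tendsto_le[OF _ tendsto_power[OF lim] tendsto_mult[OF lim lim], rotated]) simp
    qed
    ultimately show ?thesis ..
  qed
qed

lemma completely_log_concave_imp_mixed_nonneg:
  assumes "interior K \<noteq> {}" and f: "hform d f" and clc: "completely_log_concave K d f"
  shows "mixed_nonneg K d f"
  unfolding mixed_nonneg_def
proof (intro allI impI)
  fix bs assume bs: "length bs = d \<and> set bs \<subseteq> K"
  from assms(1) obtain e where "e \<in> interior K" by blast
  then have "log_concave_at (dir_derivs bs f) e"
    using clc bs by (simp add: completely_log_concave_def)
  then have "dir_derivs bs f e \<ge> 0" by (auto simp: log_concave_at_def)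
  then show "dir_derivs bs f 0 \<ge> 0"
    using dir_derivs_const_point[of bs f 0 e] f bs by simp
qed

text \<open>
  The eigenvalue count comes from log-concavity of a quadratic derivative \<open>q\<close> at an interior
  point \<open>e\<close>. If \<open>v \<bullet> Q e = 0\<close>, then \<open>D\<^sub>v q(e) = 0\<close>, and the log-concavity inequality leaves
  \<open>q(e) D\<^sub>v D\<^sub>v q(e) \<le> 0\<close>.
\<close>

lemma completely_log_concave_imp_lorentzian:
  assumes K: "proper_cone K" and f: "hform d f" and clc: "completely_log_concave K d f"
  shows "lorentzian K d f"
proof -
  have "interior K \<noteq> {}" using K by (simp add: proper_cone_def)
  then obtain e where e: "e \<in> interior K" by blast
  have nonneg: "mixed_nonneg K d f"
    using completely_log_concave_imp_mixed_nonneg \<open>interior K \<noteq> {}\<close> f clc by blast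
  have main: "num_pos_eigenvalues (quad_matrix (dir_derivs cs f)) = 1 \<and>
      (\<forall>x\<in>interior K. \<forall>y\<in>interior K. y \<bullet> (quad_matrix (dir_derivs cs f) *v x) > 0)"
    if d: "d \<ge> 2" and nz: "f \<noteq> (\<lambda>x. 0)" and cs: "length cs = d - 2" "set cs \<subseteq> interior K" for cs
  proof -
    define q where "q = dir_derivs cs f"
    let ?Q = "quad_matrix q"
    have q: "hform 2 q" unfolding q_def using hform_dir_derivs[OF f, of cs] cs d by simp
    note Q = quad_matrix_hform[OF q]
    have pos: "y \<bullet> (?Q *v x) > 0" if "x \<in> interior K" "y \<in> interior K" for x y
    proof -
      have "dir_derivs (y # x # cs) f 0 > 0"
        by (rule mixed_pos_interior[OF f nonneg nz]) (use that cs d in auto)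
      then show ?thesis using Q(2)[of y x 0] by (simp add: q_def)
    qed
    have qe: "q e > 0"
      using dir_derivs_replicate[OF q, of e 0] Q(2)[of e e 0] pos[OF e e]
      by (simp add: numeral_2_eq_2)
    have "set cs \<subseteq> K" using cs interior_subset by blast
    then have "log_concave_at q e"
      using clc e cs by (simp add: completely_log_concave_def q_def)
    then have lc: "dir_deriv v (dir_deriv v q) e * q e \<le> (dir_deriv v q e)\<^sup>2" for v
      using log_concave_at_iff[of 2 q e, OF q qe] by blast
    have "num_pos_eigenvalues ?Q = 1"
    proof (rule num_pos_eigenvalues_eq_one[OF Q(1) pos[OF e e]])
      fix v assume "v \<bullet> (?Q *v e) = 0"
      then have "dir_deriv e (dir_deriv v q) e = 0"
        using Q(2)[of e v e] symmetric_inner_commute[OF Q(1), of e v] by simp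
      then have "dir_deriv v q e = 0"
        using Euler_identity[OF hform_dir_deriv[OF q, of v], of e] by simp
      then have "dir_deriv v (dir_deriv v q) e \<le> 0"
        using lc[of v] qe by (simp add: mult_le_0_iff)
      then show "v \<bullet> (?Q *v v) \<le> 0" using Q(2)[of v v e] by simp
    qed
    then show ?thesis using pos by (simp add: q_def)
  qed
  show ?thesis
  proof (cases "d \<le> 1")
    case True
    then show ?thesis
      using mixed_nonneg_imp_nonneg[OF f nonneg] by (simp add: lorentzian_def)
  next
    case False
    then show ?thesis using main by (auto simp: lorentzian_def Let_def)
  qed
qed

theorem theorem4p10:
  fixes K :: "(real ^ 'n) set" and d :: nat
  assumes "proper_cone K"
  shows "(\<forall>f \<in> forms d. lorentzian K d f \<longleftrightarrow> completely_log_concave K d f) \<and>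
         SL d K = CLC d K"
proof -
  have "lorentzian K d f \<longleftrightarrow> completely_log_concave K d f" if "f \<in> forms d" for f
    using forms_imp_hform[OF that] assms completely_log_concave_imp_lorentzian
      lorentzian_imp_mixed_nonneg_alexandrov_fenchel completely_log_concave_if_alexandrov_fenchel
    by blast
  then show ?thesis by (auto simp: SL_def CLC_def)
qed

end
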